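(* Let $Q:\Lambda\to\mathcal{D}$ be a parameter-to-QoI map with $\Lambda$ precompact, let $(Q_n)$ be a sequence of approximations $Q_n:\Lambda\to\mathcal{D}$ of $Q$ with $Q_n\to Q$ in $L^\infty(\Lambda)$ as $n\to\infty$, let $\pi_\Lambda$ be a (prior) probability density on $\Lambda$ with push-forward densities $\pi_{\mathcal{D}}^{Q}$ and $\pi_{\mathcal{D}}^{Q_n}$ under $Q$ and $Q_n$, and let $\pi_{\mathcal{D}}$ be an (observed) probability density on $\mathcal{D}$ that is Lipschitz continuous on $\mathcal{D}$. Assume: (1) There is $B_1>0$ with $\sup_{q\in\mathcal{D}}\pi_{\mathcal{D}}^{Q}(q)\le B_1$, and $\pi_{\mathcal{D}}^{Q}$ is continuous on $\mathcal{D}$ except possibly on a set $A\subset\mathcal{D}$ with $\mu_{\mathcal{D}}(A)=0$. (2) There is $B_2>0$ such that $\sup_{q\in\mathcal{D}}\pi_{\mathcal{D}}^{Q_n}(q)\le B_2$ for every $n$. Moreover, for every $\delta>0$ there exists $N_\delta\subset\mathcal{D}$ with $A\subset N_\delta$ and $\mu_{\mathcal{D}}(N_\delta)<\delta$ such that the sequence $(\pi_{\mathcal{D}}^{Q_n})$ is asymptotically uniformly equicontinuous on $\mathcal{D}\setminus N_\delta$. (3) There is $C>0$ such that $\pi_{\mathcal{D}}(q)\le C\,\pi_{\mathcal{D}}^{Q}(q)$ for a.e. $q\in\mathcal{D}$. (4) There is $C>0$ such that, for every $n$, $\pi_{\mathcal{D}}(q)\le C\,\pi_{\mathcal{D}}^{Q_n}(q)$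 for a.e. $q\in\mathcal{D}$. Define $$\pi_\Lambda^{\mathrm{post}}(\lambda)=\pi_\Lambda(\lambda)\frac{\pi_{\mathcal{D}}(Q(\lambda))}{\pi_{\mathcal{D}}^{Q}(Q(\lambda))},\qquad \pi_\Lambda^{\mathrm{post},n}(\lambda)=\pi_\Lambda(\lambda)\frac{\pi_{\mathcal{D}}(Q_n(\lambda))}{\pi_{\mathcal{D}}^{Q_n}(Q_n(\lambda))}.$$ Then for every $\epsilon>0$ there exists $N$ such that $n>N$ implies $$\left\|\pi_\Lambda^{\mathrm{post},n}(\lambda)-\pi_\Lambda^{\mathrm{post}}(\lambda)\right\|_{L^1(\Lambda)}<\epsilon .$$
   Context: Setting. $\Lambda\subset\mathbb{R}^k$ is the parameter space (precompact means bounded in $\mathbb{R}^k$) and $\mathcal{D}:=Q(\Lambda)\subset\mathbb{R}^m$ is the data space. $(\Lambda,\mathcal{B}_\Lambda,\mu_\Lambda)$ and $(\mathcal{D},\mathcal{B}_{\mathcal{D}},\mu_{\mathcal{D}})$ are measure spaces with the Borel $\sigma$-algebras inherited from the Euclidean metric topologies, and $\mu_\Lambda,\mu_{\mathcal{D}}$ are the dominating measures with respect to which all densities and a.e. statements are taken. The map $Q$ is measurable, piecewise smooth and bounded, and (with $\Lambda$ precompact) $\mu_{\mathcal{D}}(\mathcal{D})<\infty$. Either $\mu_{\mathcal{D}}$ is defined as the push-forward of $\mu_\Lambda$ under $Q$, or the push-forward of $\mu_\Lambda$ is absolutely continuous with respect to $\mu_{\mathcal{D}}$. The approximations $Q_n$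 are also measurable maps into $\mathcal{D}$. Convergence $Q_n\to Q$ in $L^\infty(\Lambda)$ means $\|Q_n-Q\|_{L^\infty(\Lambda)}\to0$. The space $L^1(\Lambda)$ is taken with respect to $\mu_\Lambda$. Push-forward densities. $P_\Lambda$ is the probability measure on $(\Lambda,\mathcal{B}_\Lambda)$ with density $\pi_\Lambda$ with respect to $\mu_\Lambda$. $\pi_{\mathcal{D}}^{Q}$ (resp. $\pi_{\mathcal{D}}^{Q_n}$) is the density with respect to $\mu_{\mathcal{D}}$ of the push-forward measure $E\mapsto P_\Lambda(Q^{-1}(E))$ (resp. $E\mapsto P_\Lambda(Q_n^{-1}(E))$), $E\in\mathcal{B}_{\mathcal{D}}$; these push-forwards are assumed absolutely continuous with respect to $\mu_{\mathcal{D}}$. Asymptotic uniform equicontinuity. A sequence of real-valued functions $(u_n)$ on a set $S\subset\mathbb{R}^m$ is asymptotically uniformly equicontinuous on $S$ if for every $\epsilon>0$ there exist $\delta(\epsilon)>0$ and $n(\epsilon)$ such that for all $x,y\in S$ with $|y-x|<\delta(\epsilon)$ and all $n>n(\epsilon)$ one has $|u_n(y)-u_n(x)|<\epsilon$. *)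

theory Defs
  imports "HOL-Probability.Probability"
begin

definition C1_on :: "(real^'k) set \<Rightarrow> (real^'k \<Rightarrow> real^'m) \<Rightarrow> bool" where
  "C1_on U g \<longleftrightarrow>
     (\<exists>g' :: real^'k \<Rightarrow> (real^'k) \<Rightarrow>\<^sub>L (real^'m).
        (\<forall>x\<in>U. (g has_derivative blinfun_apply (g' x)) (at x)) \<and> continuous_on U g')"

text \<open>Piecewise smooth: finitely many Borel pieces, on each of which the map is the restriction
  of a continuously differentiable map defined on an open neighbourhood of the piece. As for the
  piecewise smooth paths of the library, smooth means of class C1; maps that are
  infinitely differentiable on each piece are included. The pieces may overlap, but can always
  be made disjoint.\<close>

definition piecewise_smooth_on :: "(real^'k) set \<Rightarrow> (real^'k \<Rightarrow> real^'m) \<Rightarrow> bool" where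
  "piecewise_smooth_on S f \<longleftrightarrow>
     (\<exists>\<P>. finite \<P> \<and> \<P> \<subseteq> sets (restrict_space borel S) \<and> \<Union>\<P> = S \<and>
        (\<forall>P\<in>\<P>. \<exists>U g. open U \<and> P \<subseteq> U \<and> C1_on U g \<and> (\<forall>x\<in>P. f x = g x)))"

text \<open>With values in \<open>ennreal\<close> instead of \<open>ereal\<close>, the essential supremum of the
  norm is also correct on a null measure space, where it is 0.\<close>

definition Linf_norm :: "'a measure \<Rightarrow> ('a \<Rightarrow> 'b::real_normed_vector) \<Rightarrow> ennreal" where
  "Linf_norm M f = esssup M (\<lambda>x. ennreal (norm (f x)))"

definition L1_norm :: "'a measure \<Rightarrow> ('a \<Rightarrow> real) \<Rightarrow> ennreal" where
  "L1_norm M f = (\<integral>\<^sup>+x. ennreal \<bar>f x\<bar> \<partial>M)"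

definition prob_density :: "'a measure \<Rightarrow> ('a \<Rightarrow> real) \<Rightarrow> bool" where
  "prob_density M p \<longleftrightarrow>
     p \<in> borel_measurable M \<and> (\<forall>x\<in>space M. 0 \<le> p x) \<and> (\<integral>\<^sup>+x. ennreal (p x) \<partial>M) = 1"

text \<open>\<open>q\<close> is a version of the density with respect to \<open>N\<close> of the push-forward under \<open>T\<close> of the
  measure with density \<open>p\<close> with respect to \<open>M\<close>. Existence of such a \<open>q\<close> contains the absolute
  continuity of the push-forward.\<close>

definition pushforward_density ::
  "'a measure \<Rightarrow> ('a \<Rightarrow> real) \<Rightarrow> 'b measure \<Rightarrow> ('a \<Rightarrow> 'b) \<Rightarrow> ('b \<Rightarrow> real) \<Rightarrow> bool" where
  "pushforward_density M p N T q \<longleftrightarrow>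
     (\<forall>y\<in>space N. 0 \<le> q y) \<and>
     distributed (density M (\<lambda>x. ennreal (p x))) N T (\<lambda>y. ennreal (q y))"

definition asymp_unif_equicontinuous_on ::
  "'b::metric_space set \<Rightarrow> (nat \<Rightarrow> 'b \<Rightarrow> real) \<Rightarrow> bool" where
  "asymp_unif_equicontinuous_on S u \<longleftrightarrow>
     (\<forall>\<epsilon>>0. \<exists>\<delta>>0. \<exists>n0. \<forall>x\<in>S. \<forall>y\<in>S. dist y x < \<delta> \<longrightarrow> (\<forall>n>n0. \<bar>u n y - u n x\<bar> < \<epsilon>))"

text \<open>Where the push-forward density \<open>q\<close> vanishes at \<open>T x\<close>, the quotient is 0 by the convention
  for division by zero. This happens only on a null set of the prior, so it does not affect the
  posterior density up to equality almost everywhere.\<close>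

definition posterior_density ::
  "('a \<Rightarrow> real) \<Rightarrow> ('b \<Rightarrow> real) \<Rightarrow> ('b \<Rightarrow> real) \<Rightarrow> ('a \<Rightarrow> 'b) \<Rightarrow> 'a \<Rightarrow> real" where
  "posterior_density p obs q T x = p x * (obs (T x) / q (T x))"

end

theory Submission
  imports Defs
begin

text \<open>Write \<open>P\<close> for the prior probability, \<open>q\<close> and \<open>q\<^sub>n\<close> for the push-forward densities of \<open>P\<close>
  under \<open>Q\<close> and \<open>Q\<^sub>n\<close>, \<open>p\<close> for the observed density, \<open>N\<close> for the measure on the data space, and
  \<open>r = p/q\<close>. The distance of the posteriors is the \<open>L1(P)\<close> distance of \<open>(p/q\<^sub>n) \<circ> Q\<^sub>n\<close> and
  \<open>r \<circ> Q\<close>. Inserting \<open>r \<circ> Q\<^sub>n\<close> splits the error into two parts.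

  The first part compares two ratios along the same map. Transported to the data space, it is the
  \<open>N\<close>-integral of \<open>q\<^sub>n * \<bar>p/q\<^sub>n - p/q\<bar>\<close>, which is at most \<open>r * \<bar>q\<^sub>n - q\<bar>\<close> almost everywhere,
  and \<open>r \<le> C\<close> almost everywhere because \<open>p \<le> C * q\<close>. So it is at most \<open>C\<close> times the \<open>L1(N)\<close>
  distance of the push-forward densities (lemma \<open>L1_norm_ratio_le\<close>).

  The second part compares the values of one function, \<open>r\<close>, along \<open>Q\<^sub>n\<close> and \<open>Q\<close>. Since all
  push-forward densities are bounded by one constant, composition with \<open>Q\<^sub>n\<close> is bounded from
  \<open>L1(N)\<close> to \<open>L1(P)\<close> uniformly in \<open>n\<close>. For bounded continuous functions the compositions
  converge, because \<open>Q\<^sub>n\<close> tends to \<open>Q\<close> almost everywhere, and such functions are dense in \<open>L1(N)\<close>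
  (lemma \<open>L1_convergence_comp\<close>).

  It remains to see that \<open>q\<^sub>n\<close> tends to \<open>q\<close> in \<open>L1(N)\<close>. The same composition lemma, applied to
  indicators, shows that the integrals of \<open>q\<^sub>n\<close> over each measurable set converge to that of \<open>q\<close>.
  Outside a set of small measure, asymptotic equicontinuity and total boundedness of the data space
  make \<open>q\<^sub>n\<close> uniformly close to its averages over finitely many small sets; since these averages
  converge, \<open>q\<^sub>n\<close> is uniformly Cauchy there, and the set integrals identify its limit as \<open>q\<close>. On the
  exceptional set the uniform bounds on the densities control the error
  (lemma \<open>L1_convergence_of_set_integrals\<close>).\<close>

section \<open>Convergence in the L1 norm\<close>
lemma ennreal_tendsto_0I:
  fixes X :: "'a \<Rightarrow> ennreal"
  assumes "\<And>e::real. e > 0 \<Longrightarrow> eventually (\<lambda>n. X n \<le> ennreal e) F"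
  shows "(X \<longlongrightarrow> 0) F"
proof (rule order_tendstoI)
  fix a :: ennreal assume "0 < a"
  then obtain e where e: "0 < e" "e < a" using dense by blast
  then have "e < top" using less_trans[OF e(2)] by (metis less_top top.extremum_strict)
  then obtain r where r: "e = ennreal r" "r \<ge> 0" by (cases e) auto
  with e have "r > 0" by auto
  from assms[OF this] show "\<forall>\<^sub>F n in F. X n < a"
    by eventually_elim (use e r in auto)
qed auto

lemma ennreal_tendsto_0D:
  fixes X :: "'a \<Rightarrow> ennreal"
  assumes "(X \<longlongrightarrow> 0) F" "(e::real) > 0"
  shows "eventually (\<lambda>n. X n < ennreal e) F"
  using order_tendstoD(2)[OF assms(1), of "ennreal e"] assms(2) by auto

lemma L1_norm_triangle:
  assumes [measurable]: "f \<in> borel_measurable M" "g \<in> borel_measurable M" "h \<in> borel_measurable M"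
  shows "L1_norm M (\<lambda>x. f x - h x) \<le> L1_norm M (\<lambda>x. f x - g x) + L1_norm M (\<lambda>x. g x - h x)"
proof -
  have "ennreal \<bar>f x - h x\<bar> \<le> ennreal \<bar>f x - g x\<bar> + ennreal \<bar>g x - h x\<bar>" for x
    by (auto simp flip: ennreal_plus intro!: ennreal_leI)
  then show ?thesis
    unfolding L1_norm_def by (subst nn_integral_add[symmetric]) (auto intro!: nn_integral_mono)
qed

lemma L1_norm_minus_commute: "L1_norm M (\<lambda>x. f x - g x) = L1_norm M (\<lambda>x. g x - f x)"
  unfolding L1_norm_def by (simp add: abs_minus_commute)

lemma L1_norm_cmult:
  assumes [measurable]: "f \<in> borel_measurable M"
  shows "L1_norm M (\<lambda>x. c * f x) = ennreal \<bar>c\<bar> * L1_norm M f"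
  unfolding L1_norm_def by (simp add: abs_mult ennreal_mult nn_integral_cmult)

section \<open>Continuous functions are dense in L1\<close>

text \<open>The data space is the image of an arbitrary bounded set and need not be a Borel set. A
  measure on its trace \<open>\<sigma>\<close>-algebra is therefore not literally a Borel measure, but
  continuous functions on the whole space are still measurable for it and serve as test functions.\<close>
lemma borel_measurable_restrict_continuous:
  fixes g :: "'b::topological_space \<Rightarrow> 'c::topological_space"
  assumes "sets M = sets (restrict_space borel S)" "continuous_on UNIV g"
  shows "g \<in> borel_measurable M"
  using measurable_restrict_space1[OF borel_measurable_continuous_onI[OF assms(2)], of S]
  by (simp add: measurable_cong_sets[OF assms(1) refl])

text \<open>Inner and outer regularity squeeze a Borel set between a compact set \<open>K\<close> and an open set
  \<open>U\<close> whose difference has small measure; a Urysohn function for \<open>K\<close> and the complement of \<open>U\<close>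
  differs from the indicator only on that difference. Regularity is applied to the image of the
  measure under the inclusion, a Borel measure on the whole space.\<close>
lemma indicator_approx_continuous:
  fixes M :: "'b::euclidean_space measure"
  assumes "finite_measure M" and setsM: "sets M = sets (restrict_space borel S)"
    and B: "B \<in> sets M" and e: "e > 0"
  obtains g :: "'b \<Rightarrow> real" where "continuous_on UNIV g" "\<And>x. 0 \<le> g x" "\<And>x. g x \<le> 1"
    "L1_norm M (\<lambda>x. indicator B x - g x) \<le> ennreal e"
proof -
  interpret finite_measure M by fact
  define N where "N = distr M borel (\<lambda>x. x)"
  have id[measurable]: "(\<lambda>x. x) \<in> borel_measurable M"
    by (rule borel_measurable_restrict_continuous[OF setsM]) (rule continuous_on_id)
  have [simp]: "sets N = sets borel" "space N = UNIV" by (auto simp: N_def)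
  interpret N: finite_measure N unfolding N_def by (rule finite_measure_distr) fact
  obtain E where E: "E \<in> sets borel" "B = S \<inter> E"
    using B unfolding setsM sets_restrict_space by auto
  have spM: "space M = S"
    using sets_eq_imp_space_eq[OF setsM] by (simp add: space_restrict_space)
  have ne: "emeasure N (space N) \<noteq> \<infinity>" by (simp add: N.emeasure_finite)
  have e2: "e/2 > 0" using e by simp
  have "\<exists>K\<in>{K. K \<subseteq> E \<and> compact K}. emeasure N E < emeasure N K + ennreal (e/2)"
    by (rule SUP_approx_ennreal[OF e2 _ inner_regular[OF \<open>sets N = sets borel\<close> ne E(1)]])
       (auto simp: N.emeasure_finite)
  then obtain K where K: "K \<subseteq> E" "compact K" "emeasure N E < emeasure N K + ennreal (e/2)" by auto
  have "\<exists>U\<in>{U. E \<subseteq> U \<and> open U}. emeasure N U < emeasure N E + ennreal (e/2)"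
    by (rule INF_approx_ennreal[OF e2 outer_regular[OF \<open>sets N = sets borel\<close> ne E(1)]])
       (auto simp: N.emeasure_finite)
  then obtain U where U: "E \<subseteq> U" "open U" "emeasure N U < emeasure N E + ennreal (e/2)" by auto
  have KU: "K \<in> sets borel" "U \<in> sets borel" using K U by (auto intro: borel_compact)
  obtain g :: "'b \<Rightarrow> real" where g: "continuous_on UNIV g" "\<And>x. g x \<in> closed_segment 1 0"
     "\<And>x. x \<in> K \<Longrightarrow> g x = 1" "\<And>x. x \<in> - U \<Longrightarrow> g x = 0"
    using Urysohn[of K "-U" 1 0] K U compact_imp_closed by blast
  have g01: "0 \<le> g x" "g x \<le> 1" for x using g(2)[of x] by (auto simp: closed_segment_eq_real_ivl)
  have "L1_norm M (\<lambda>x. indicator B x - g x) \<le> (\<integral>\<^sup>+x. indicator (U - K) x \<partial>M)"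
    unfolding L1_norm_def
  proof (rule nn_integral_mono)
    fix x assume "x \<in> space M"
    then have "indicator B x = (indicator E x :: real)" using E spM by (auto simp: indicator_def)
    then show "ennreal \<bar>indicator B x - g x\<bar> \<le> indicator (U - K) x"
      using g01[of x] g(3,4)[of x] K(1) U(1) 
      by (auto simp: indicator_def abs_if ennreal_le_1)
  qed
  also have "\<dots> = emeasure N (U - K)"
    using nn_integral_distr[OF id, of "indicator (U - K)"] nn_integral_indicator[of "U - K" N] KU
    by (simp add: N_def)
  also have "\<dots> = measure N U - measure N K"
    using KU K(1) U(1) by (subst N.emeasure_eq_measure, subst N.finite_measure_Diff) auto
  also have "\<dots> \<le> ennreal e"
  proof -
    have "measure N E < measure N K + e/2" "measure N U < measure N E + e/2"
      using K(3) U(3) e by (auto simp: N.emeasure_eq_measure ennreal_less_iff simp flip: ennreal_plus)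
    then show ?thesis by (intro ennreal_leI) auto
  qed
  finally show ?thesis using that g(1) g01 by blast
qed

text \<open>Induction over integrable functions reduces the density of bounded continuous functions to
  indicators. In the limit step, dominated convergence turns pointwise into L1 approximation.\<close>
lemma integrable_approx_continuous:
  fixes M :: "'b::euclidean_space measure" and f :: "'b \<Rightarrow> real"
  assumes fin: "finite_measure M" and setsM: "sets M = sets (restrict_space borel S)"
    and "integrable M f" and "e > 0"
  shows "\<exists>g. continuous_on UNIV g \<and> bounded (range g) \<and> L1_norm M (\<lambda>x. f x - g x) \<le> ennreal e"
  using assms(3,4)
proof (induction arbitrary: e)
  case (base B c)
  \<comment> \<open>adding 1 to \<open>\<bar>c\<bar>\<close> covers \<open>c = 0\<close>\<close>
  obtain g :: "'b \<Rightarrow> real" where g: "continuous_on UNIV g" "\<And>x. 0 \<le> g x" "\<And>x. g x \<le> 1"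
    "L1_norm M (\<lambda>x. indicator B x - g x) \<le> ennreal (e / (\<bar>c\<bar> + 1))"
    using indicator_approx_continuous[OF fin setsM base(1), of "e / (\<bar>c\<bar> + 1)"] base by auto
  have [measurable]: "g \<in> borel_measurable M" "B \<in> sets M"
    using borel_measurable_restrict_continuous[OF setsM g(1)] base by auto
  have "L1_norm M (\<lambda>x. c * (indicator B x - g x)) \<le> ennreal \<bar>c\<bar> * ennreal (e / (\<bar>c\<bar> + 1))"
    by (subst L1_norm_cmult) (use g in \<open>auto intro: mult_left_mono\<close>)
  also have "\<dots> = ennreal (\<bar>c\<bar> * (e / (\<bar>c\<bar> + 1)))"
    using base by (simp flip: ennreal_mult)
  also have "\<dots> \<le> ennreal e"
    using base by (intro ennreal_leI) (auto simp: field_simps)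
  finally have "L1_norm M (\<lambda>x. indicator B x *\<^sub>R c - c * g x) \<le> ennreal e"
    by (simp add: algebra_simps)
  moreover have "bounded (range (\<lambda>x. c * g x))"
    unfolding bounded_iff using g(2,3) 
    by (intro exI[of _ "\<bar>c\<bar>"]) (auto simp: abs_mult mult_left_le)
  ultimately show ?case using g(1)
    by (intro exI[of _ "\<lambda>x. c * g x"]) (auto intro!: continuous_intros)
next
  case (add f1 f2)
  from add(3,4)[of "e/2"] add(5) obtain g1 g2 where
    g: "continuous_on UNIV g1" "continuous_on UNIV g2" "bounded (range g1)" "bounded (range g2)"
      "L1_norm M (\<lambda>x. f1 x - g1 x) \<le> ennreal (e/2)" "L1_norm M (\<lambda>x. f2 x - g2 x) \<le> ennreal (e/2)"
    by (metis half_gt_zero)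
  note [measurable] = borel_measurable_restrict_continuous[OF setsM g(1)]
    borel_measurable_restrict_continuous[OF setsM g(2)]
    borel_measurable_integrable[OF add(1)] borel_measurable_integrable[OF add(2)]
  have "L1_norm M (\<lambda>x. (f1 x + f2 x) - (g1 x + g2 x)) 
      \<le> L1_norm M (\<lambda>x. (f1 x + f2 x) - (g1 x + f2 x)) + L1_norm M (\<lambda>x. (g1 x + f2 x) - (g1 x + g2 x))"
    by (rule L1_norm_triangle) auto
  also have "\<dots> \<le> ennreal (e/2) + ennreal (e/2)"
    using g by (intro add_mono) auto
  also have "\<dots> = ennreal e" using add(5) by (simp flip: ennreal_plus)
  finally show ?case using g(1,2) bounded_plus_comp[OF g(3,4)]
    by (intro exI[of _ "\<lambda>x. g1 x + g2 x"]) (auto intro!: continuous_intros)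
next
  case (lim f s)
  note [measurable] = borel_measurable_integrable[OF lim(1)] borel_measurable_integrable[OF lim(4)]
  have "(\<lambda>i. \<integral>\<^sup>+x. norm (f x - s i x) \<partial>M) \<longlonglongrightarrow> 0"
  proof (rule nn_integral_dominated_convergence_norm[where w="\<lambda>x. 2 * norm (f x)"])
    show "(\<integral>\<^sup>+x. ennreal (2 * norm (f x)) \<partial>M) < \<infinity>"
      using lim(4) unfolding integrable_iff_bounded
      by (simp add: ennreal_mult nn_integral_cmult ennreal_mult_less_top)
  qed (use lim in auto)
  then have "\<forall>\<^sub>F i in sequentially. L1_norm M (\<lambda>x. f x - s i x) < ennreal (e/2)"
    unfolding L1_norm_def using lim(6) by (intro ennreal_tendsto_0D) auto
  then obtain i where i: "L1_norm M (\<lambda>x. f x - s i x) < ennreal (e/2)"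
    by (auto simp: eventually_sequentially)
  from lim(5)[of "e/2" i] lim(6) obtain g where g: "continuous_on UNIV g" "bounded (range g)"
    "L1_norm M (\<lambda>x. s i x - g x) \<le> ennreal (e/2)" by auto
  have [measurable]: "g \<in> borel_measurable M"
    using borel_measurable_restrict_continuous[OF setsM g(1)] .
  have "L1_norm M (\<lambda>x. f x - g x) \<le> L1_norm M (\<lambda>x. f x - s i x) + L1_norm M (\<lambda>x. s i x - g x)"
    by (rule L1_norm_triangle) auto
  also have "\<dots> \<le> ennreal (e/2) + ennreal (e/2)" using i g by (intro add_mono) auto
  also have "\<dots> = ennreal e" using lim(6) by (simp flip: ennreal_plus)
  finally show ?case using g by blast
qed

section \<open>Composition with a converging sequence of maps\<close>
lemma AE_tendsto_of_Linf_norm: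
  assumes "(\<lambda>n. Linf_norm M (\<lambda>x. T' n x - T x)) \<longlonglongrightarrow> 0"
  shows "AE x in M. (\<lambda>n. T' n x) \<longlonglongrightarrow> T x"
proof -
  have "AE x in M. \<forall>n. ennreal (norm (T' n x - T x)) \<le> Linf_norm M (\<lambda>x. T' n x - T x)"
    unfolding AE_all_countable Linf_norm_def by (auto intro: esssup_AE)
  then show ?thesis
  proof eventually_elim
    case (elim x)
    have "(\<lambda>n. ennreal (norm (T' n x - T x))) \<longlonglongrightarrow> 0"
      by (rule tendsto_sandwich[OF _ _ tendsto_const assms]) (use elim in auto)
    then have "(\<lambda>n. norm (T' n x - T x)) \<longlonglongrightarrow> 0"
      by (simp add: ennreal_tendsto_0_iff)
    then show ?case by (simp add: LIM_zero_iff tendsto_norm_zero_iff)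
  qed
qed

text \<open>A bounded push-forward density makes composition with \<open>T\<close> a bounded operator from \<open>L1(N)\<close>
  to \<open>L1(P)\<close>, with a bound that depends on the density only through its supremum.\<close>
lemma L1_norm_comp_le:
  assumes T: "distributed P N T (\<lambda>y. ennreal (q y))" and q: "\<And>y. y \<in> space N \<Longrightarrow> q y \<le> b"
    and h[measurable]: "h \<in> borel_measurable N"
  shows "L1_norm P (\<lambda>x. h (T x)) \<le> ennreal b * L1_norm N h"
proof -
  have "L1_norm P (\<lambda>x. h (T x)) = (\<integral>\<^sup>+y. ennreal (q y) * ennreal \<bar>h y\<bar> \<partial>N)"
    unfolding L1_norm_def by (rule distributed_nn_integral[OF T, symmetric]) auto
  also have "\<dots> \<le> (\<integral>\<^sup>+y. ennreal b * ennreal \<bar>h y\<bar> \<partial>N)"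
    by (intro nn_integral_mono mult_right_mono ennreal_leI q) auto
  also have "\<dots> = ennreal b * L1_norm N h"
    unfolding L1_norm_def by (rule nn_integral_cmult) auto
  finally show ?thesis .
qed

text \<open>For bounded continuous \<open>f\<close> this is dominated convergence. The composition operators of all
  \<open>T' n\<close> and of \<open>T\<close> share the bound \<open>b\<close>, so the convergence passes from the dense set of bounded
  continuous functions to all of \<open>L1(N)\<close>. The lemma serves for two discontinuous \<open>f\<close>: the
  indicator of a measurable set and the ratio of two densities.\<close>
lemma L1_convergence_comp:
  fixes N :: "'b::euclidean_space measure" and f :: "'b \<Rightarrow> real"
  assumes finP: "finite_measure P" and finN: "finite_measure N"
    and setsN: "sets N = sets (restrict_space borel S)"
    and Tn: "\<And>n. distributed P N (T' n) (\<lambda>y. ennreal (q' n y))"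
    and T: "distributed P N T (\<lambda>y. ennreal (q y))"
    and qn: "\<And>n y. y \<in> space N \<Longrightarrow> q' n y \<le> b" and q: "\<And>y. y \<in> space N \<Longrightarrow> q y \<le> b"
    and conv: "AE x in P. (\<lambda>n. T' n x) \<longlonglongrightarrow> T x"
    and f: "integrable N f"
  shows "(\<lambda>n. L1_norm P (\<lambda>x. f (T' n x) - f (T x))) \<longlonglongrightarrow> 0"
proof (rule ennreal_tendsto_0I)
  fix e :: real assume e: "e > 0"
  interpret finite_measure P by fact
  \<comment> \<open>a positive bound, so that it can be divided by\<close>
  define b' where "b' = max b 1"
  define d where "d = e / 3 / b'"
  have b': "b' > 0" "b \<le> b'" by (auto simp: b'_def)
  have d: "d > 0" using e b' by (simp add: d_def)
  obtain g where g: "continuous_on UNIV g" "bounded (range g)" "L1_norm N (\<lambda>x. f x - g x) \<le> ennreal d"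
    using integrable_approx_continuous[OF finN setsN f d] by blast
  note [measurable] = borel_measurable_restrict_continuous[OF setsN g(1)]
    borel_measurable_integrable[OF f] distributed_measurable[OF Tn] distributed_measurable[OF T]
  have close: "L1_norm P (\<lambda>x. f (U x) - g (U x)) \<le> ennreal (e/3)"
    if "distributed P N U (\<lambda>y. ennreal (r y))" "\<And>y. y \<in> space N \<Longrightarrow> r y \<le> b" for U r
  proof -
    have "L1_norm P (\<lambda>x. f (U x) - g (U x)) \<le> ennreal b' * L1_norm N (\<lambda>y. f y - g y)"
      by (rule L1_norm_comp_le[OF that(1)]) (use that(2) b' in \<open>auto intro: order_trans\<close>)
    also have "\<dots> \<le> ennreal b' * ennreal d" using g by (intro mult_left_mono) auto
    also have "\<dots> = ennreal (e/3)" using b' d by (simp add: d_def flip: ennreal_mult)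
    finally show ?thesis .
  qed
  obtain c where c: "\<And>x. \<bar>g x\<bar> \<le> c" using g(2) unfolding bounded_iff by auto
  have "(\<lambda>n. \<integral>\<^sup>+x. norm (g (T x) - g (T' n x)) \<partial>P) \<longlonglongrightarrow> 0"
  proof (rule nn_integral_dominated_convergence_norm[where w="\<lambda>x. c"])
    show "(\<integral>\<^sup>+x. ennreal c \<partial>P) < \<infinity>"
      by (simp add: emeasure_eq_measure ennreal_mult_less_top)
    show "AE x in P. (\<lambda>n. g (T' n x)) \<longlonglongrightarrow> g (T x)"
      using conv by eventually_elim (use g(1) in \<open>auto intro: continuous_on_tendsto_compose\<close>)
  qed (use c in auto)
  then have "\<forall>\<^sub>F n in sequentially. L1_norm P (\<lambda>x. g (T x) - g (T' n x)) < ennreal (e/3)"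
    unfolding L1_norm_def using e by (intro ennreal_tendsto_0D) auto
  then show "\<forall>\<^sub>F n in sequentially. L1_norm P (\<lambda>x. f (T' n x) - f (T x)) \<le> ennreal e"
  proof eventually_elim
    case (elim n)
    have "L1_norm P (\<lambda>x. f (T' n x) - f (T x))
      \<le> L1_norm P (\<lambda>x. f (T' n x) - g (T' n x)) + L1_norm P (\<lambda>x. g (T' n x) - f (T x))"
      by (rule L1_norm_triangle) auto
    also have "\<dots> \<le> L1_norm P (\<lambda>x. f (T' n x) - g (T' n x)) +
       (L1_norm P (\<lambda>x. g (T' n x) - g (T x)) + L1_norm P (\<lambda>x. g (T x) - f (T x)))"
      by (intro add_left_mono L1_norm_triangle) auto
    also have "\<dots> \<le> ennreal (e/3) + (ennreal (e/3) + ennreal (e/3))"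
      using close[OF Tn qn, of n] close[OF T q] elim
      by (intro add_mono) (auto simp: L1_norm_minus_commute[of P "\<lambda>x. g (T x)"])
    also have "\<dots> = ennreal e" using e by (simp flip: ennreal_plus)
    finally show ?case .
  qed
qed

section \<open>Convergence of the push-forward densities\<close>

text \<open>The integral of a push-forward density over \<open>E\<close> is the \<open>P\<close>-probability that the map lands in
  \<open>E\<close>. Composition with the indicator of \<open>E\<close> gives convergence for every measurable \<open>E\<close>, which is
  stronger than weak convergence of the push-forward measures.\<close>
lemma set_integral_density_convergence:
  fixes N :: "'b::euclidean_space measure"
  assumes finP: "finite_measure P" and finN: "finite_measure N"
    and setsN: "sets N = sets (restrict_space borel S)"
    and Tn: "\<And>n. distributed P N (T' n) (\<lambda>y. ennreal (q' n y))"
    and T: "distributed P N T (\<lambda>y. ennreal (q y))"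
    and qn0: "\<And>n y. y \<in> space N \<Longrightarrow> 0 \<le> q' n y" and q0: "\<And>y. y \<in> space N \<Longrightarrow> 0 \<le> q y"
    and qn: "\<And>n y. y \<in> space N \<Longrightarrow> q' n y \<le> b" and q: "\<And>y. y \<in> space N \<Longrightarrow> q y \<le> b"
    and conv: "AE x in P. (\<lambda>n. T' n x) \<longlonglongrightarrow> T x"
    and E: "E \<in> sets N"
  shows "(\<lambda>n. set_lebesgue_integral N E (q' n)) \<longlonglongrightarrow> set_lebesgue_integral N E q"
proof -
  interpret P: finite_measure P by fact
  interpret N: finite_measure N by fact
  note [measurable] = distributed_measurable[OF Tn] distributed_measurable[OF T] E
  have int: "set_lebesgue_integral N E r = (\<integral>x. indicator E (U x) \<partial>P)"
    if "distributed P N U (\<lambda>y. ennreal (r y))" "\<And>y. y \<in> space N \<Longrightarrow> 0 \<le> r y" for U r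
    using distributed_integral[OF that(1) _ that(2), of "indicator E"]
    by (simp add: set_lebesgue_integral_def mult.commute)
  have intE: "integrable N (indicator E :: _ \<Rightarrow> real)"
    by (simp add: N.emeasure_finite less_top[symmetric])
  have ind: "integrable P (\<lambda>x. indicator E (U x) :: real)" if "U \<in> measurable P N" for U
    using that by (intro P.integrable_const_bound[where B=1]) (auto simp: indicator_def)
  have "(\<lambda>n. L1_norm P (\<lambda>x. indicator E (T' n x) - indicator E (T x))) \<longlonglongrightarrow> 0"
    by (rule L1_convergence_comp[OF finP finN setsN Tn T qn q conv intE])
  then have "(\<lambda>n. \<integral>x. indicator E (T' n x) \<partial>P) \<longlonglongrightarrow> (\<integral>x. indicator E (T x) \<partial>P :: real)"
    unfolding L1_norm_def by (intro tendsto_L1_int ind) auto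
  then show ?thesis by (simp add: int[OF Tn qn0] int[OF T q0])
qed

text \<open>Equicontinuity upgrades convergence of averages to uniform convergence. Cover \<open>G\<close> by finitely
  many small pieces on which every late \<open>u n\<close> oscillates by at most \<open>e/3\<close>. On a piece of positive
  measure \<open>u n\<close> lies within \<open>e/3\<close> of its mean, and the means, being normalized set integrals, form
  Cauchy sequences. The pieces of measure zero are discarded, hence only an almost everywhere bound.\<close>
lemma AE_uniformly_Cauchy_of_set_integrals:
  fixes N :: "'b::euclidean_space measure"
  assumes finN: "finite_measure N" and bd: "bounded (space N)"
    and setsN: "sets N = sets (restrict_space borel S)"
    and meas: "\<And>n. u n \<in> borel_measurable N"
    and bound: "\<And>n y. y \<in> space N \<Longrightarrow> \<bar>u n y\<bar> \<le> b"
    and conv: "\<And>E. E \<in> sets N \<Longrightarrow> convergent (\<lambda>n. set_lebesgue_integral N E (u n))"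
    and G: "G \<in> sets N" and eq: "asymp_unif_equicontinuous_on G u" and e: "e > 0"
  shows "\<exists>k. \<forall>n\<ge>k. \<forall>m\<ge>k. AE x in N. x \<in> G \<longrightarrow> \<bar>u n x - u m x\<bar> \<le> e"
proof -
  interpret finite_measure N by fact
  note [measurable] = meas G
  have e3: "e/3 > 0" using e by simp
  obtain d n0 where d: "d > 0" 
    "\<And>x y n. x \<in> G \<Longrightarrow> y \<in> G \<Longrightarrow> dist y x < d \<Longrightarrow> n > n0 \<Longrightarrow> \<bar>u n y - u n x\<bar> < e/3"
    using eq e3 unfolding asymp_unif_equicontinuous_on_def by metis
  have "compact (closure (space N))" using bd by (simp add: compact_closure)
  then obtain C where C: "finite C" "closure (space N) \<subseteq> (\<Union>c\<in>C. ball c (d/2))"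
    using d(1) unfolding compact_eq_totally_bounded by (metis half_gt_zero)
  define H where "H c = G \<inter> ball c (d/2)" for c
  have spN: "space N = S"
    using sets_eq_imp_space_eq[OF setsN] by (simp add: space_restrict_space)
  have H[measurable]: "H c \<in> sets N" for c
  proof -
    have "S \<inter> ball c (d/2) \<in> sets N" unfolding setsN sets_restrict_space by auto
    moreover have "H c = G \<inter> (S \<inter> ball c (d/2))"
      using sets.sets_into_space[OF G] spN by (auto simp: H_def)
    ultimately show ?thesis using G by auto
  qed
  have osc: "\<bar>u n y - u n x\<bar> \<le> e/3" if "x \<in> H c" "y \<in> H c" "n > n0" for x y n c
  proof -
    have "dist y x < d" using that dist_triangle_half_r[of c y d x] by (auto simp: H_def)
    then show ?thesis using d(2)[of x y n] that by (auto simp: H_def)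
  qed
  \<comment> \<open>Means are kept multiplied by the measure of the piece, which avoids dividing by zero.\<close>
  define I where "I n c = set_lebesgue_integral N (H c) (u n)" for n c
  have intble: "set_integrable N (H c) (u n)" for n c
    unfolding set_integrable_def using bound
    by (intro integrable_mult_indicator[OF H] integrable_const_bound[where B=b]) (use bound in simp_all)
  have const: "set_integrable N (H c) (\<lambda>y. a)" "(LINT y:H c|N. a) = measure N (H c) * a" for c and a :: real
    unfolding set_integrable_def set_lebesgue_integral_def
    by (rule integrable_mult_indicator[OF H]) auto
  have mean: "\<bar>measure N (H c) * u n x - I n c\<bar> \<le> measure N (H c) * (e/3)"
    if x: "x \<in> H c" and n: "n > n0" for x n c
  proof -
    have "measure N (H c) * u n x - I n c = (LINT y:H c|N. u n x - u n y)"
      using set_integral_diff(2)[OF const(1)[of c "u n x"] intble[of c n]] const(2)[of c "u n x"]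
      by (simp add: I_def)
    also have "\<bar>\<dots>\<bar> \<le> (LINT y:H c|N. e/3)"
      unfolding set_lebesgue_integral_def
    proof (rule integral_abs_bound_integral)
      show "integrable N (\<lambda>y. indicator (H c) y *\<^sub>R (u n x - u n y))"
        using set_integral_diff(1)[OF const(1)[of c "u n x"] intble[of c n]]
        by (simp add: set_integrable_def)
      show "integrable N (\<lambda>y. indicator (H c) y *\<^sub>R (e/3))"
        using const(1) by (simp add: set_integrable_def)
      show "\<bar>indicator (H c) y *\<^sub>R (u n x - u n y)\<bar> \<le> indicator (H c) y *\<^sub>R (e/3)" for y
        using osc[OF _ x n, of y] by (auto simp: indicator_def)
    qed
    also have "\<dots> = measure N (H c) * (e/3)" by (rule const(2))
    finally show ?thesis .
  qed
  define C' where "C' = {c\<in>C. measure N (H c) > 0}"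
  have "\<exists>k. \<forall>n\<ge>k. \<forall>m\<ge>k. \<bar>I n c - I m c\<bar> < measure N (H c) * (e/3)" if "c \<in> C'" for c
  proof -
    have "Cauchy (\<lambda>n. I n c)" unfolding I_def by (intro convergent_Cauchy conv H)
    moreover have "measure N (H c) * (e/3) > 0" using that e by (auto simp: C'_def)
    ultimately show ?thesis unfolding Cauchy_def dist_real_def by blast
  qed
  then obtain k where k: "\<And>c n m. c \<in> C' \<Longrightarrow> n \<ge> k c \<Longrightarrow> m \<ge> k c \<Longrightarrow> 
      \<bar>I n c - I m c\<bar> < measure N (H c) * (e/3)"
    by metis
  define K where "K = Max (insert (Suc n0) (k ` C'))"
  have "finite C'" using C by (simp add: C'_def)
  then have K: "K > n0" "\<And>c. c \<in> C' \<Longrightarrow> K \<ge> k c"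
    unfolding K_def by (auto simp: Suc_le_eq[symmetric])
  have "AE x in N. x \<notin> (\<Union>c\<in>C - C'. H c)"
  proof (rule AE_not_in, rule null_sets.finite_UN)
    show "finite (C - C')" using C by auto
    show "H c \<in> null_sets N" if "c \<in> C - C'" for c
      using that measure_nonneg[of N "H c"] by (intro null_setsI) (auto simp: C'_def emeasure_eq_measure)
  qed
  then have *: "AE x in N. x \<in> G \<longrightarrow> (\<exists>c\<in>C'. x \<in> H c)"
    using AE_space
  proof eventually_elim
    case (elim x)
    have "x \<in> closure (space N)" using elim closure_subset by blast
    then obtain c where "c \<in> C" "x \<in> ball c (d/2)" using C(2) by auto
    then show ?case using elim by (auto simp: H_def)
  qed
  show ?thesis
  proof (intro exI[of _ K] allI impI)
    fix n m assume nm: "K \<le> n" "K \<le> m"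
    show "AE x in N. x \<in> G \<longrightarrow> \<bar>u n x - u m x\<bar> \<le> e"
      using *
    proof (eventually_elim, intro impI)
      fix x assume "x \<in> G \<longrightarrow> (\<exists>c\<in>C'. x \<in> H c)" "x \<in> G"
      then obtain c where c: "c \<in> C'" "x \<in> H c" by auto
      have third: "measure N (H c) * e = 3 * (measure N (H c) * (e/3))" by simp
      have pos: "measure N (H c) > 0" using c by (simp add: C'_def)
      have "\<bar>I n c - I m c\<bar> < measure N (H c) * (e/3)"
        using k[OF c(1), of n m] K(2)[OF c(1)] nm by auto
      moreover have "\<bar>measure N (H c) * u n x - I n c\<bar> \<le> measure N (H c) * (e/3)"
        "\<bar>measure N (H c) * u m x - I m c\<bar> \<le> measure N (H c) * (e/3)"
        using mean[OF c(2)] K nm by auto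
      ultimately have "\<bar>measure N (H c) * u n x - measure N (H c) * u m x\<bar> \<le> measure N (H c) * e"
        using third by linarith
      then have "measure N (H c) * \<bar>u n x - u m x\<bar> \<le> measure N (H c) * e"
        using pos by (simp add: abs_mult flip: right_diff_distrib)
      then show "\<bar>u n x - u m x\<bar> \<le> e" using pos by simp
    qed
  qed
qed

text \<open>Outside a set \<open>X\<close> of small measure the sequence is uniformly Cauchy almost everywhere. Testing
  against a set \<open>E\<close> and letting the second index tend to infinity identifies the limit: the integral
  of \<open>u' n - u\<close> over any \<open>E\<close> disjoint from \<open>X\<close> is small, uniformly in \<open>E\<close>. Taking for \<open>E\<close> the sets
  where \<open>u' n - u\<close> is nonnegative and negative bounds the integral of its modulus. On \<open>X\<close> the uniform
  bound \<open>b\<close> suffices.\<close>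
lemma L1_convergence_of_set_integrals:
  fixes N :: "'b::euclidean_space measure"
  assumes finN: "finite_measure N" and bd: "bounded (space N)"
    and setsN: "sets N = sets (restrict_space borel S)"
    and meas: "\<And>n. u' n \<in> borel_measurable N" "u \<in> borel_measurable N"
    and bound: "\<And>n y. y \<in> space N \<Longrightarrow> \<bar>u' n y\<bar> \<le> b" "\<And>y. y \<in> space N \<Longrightarrow> \<bar>u y\<bar> \<le> b"
    and conv: "\<And>E. E \<in> sets N \<Longrightarrow>
       (\<lambda>n. set_lebesgue_integral N E (u' n)) \<longlonglongrightarrow> set_lebesgue_integral N E u"
    and eq: "\<And>d. d > 0 \<Longrightarrow> \<exists>X\<in>sets N. emeasure N X < ennreal d \<and>
       asymp_unif_equicontinuous_on (space N - X) u'"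
  shows "(\<lambda>n. L1_norm N (\<lambda>x. u' n x - u x)) \<longlonglongrightarrow> 0"
proof (rule ennreal_tendsto_0I)
  fix e :: real assume e: "e > 0"
  interpret finite_measure N by fact
  note [measurable] = meas
  \<comment> \<open>\<open>b'\<close> and \<open>V\<close> enlarge the bound and the total mass to positive numbers, since both are divided by.
    The constants below give each sign set a contribution \<open>t * V = e/3\<close> and \<open>X\<close> at most
    \<open>2 * b' * e / (6 * b') = e/3\<close>.\<close>
  define b' where "b' = max b 1"
  have b': "b' > 0" "b \<le> b'" by (auto simp: b'_def)
  define V where "V = measure N (space N) + 1"
  have V: "V > 0" "measure N X \<le> V" for X
    unfolding V_def using bounded_measure[of X] measure_nonneg[of N "space N"] by linarith+
  obtain X where X[measurable]: "X \<in> sets N" and Xd: "emeasure N X < ennreal (e / (6 * b'))"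
    and Xeq: "asymp_unif_equicontinuous_on (space N - X) u'"
    using eq[of "e / (6 * b')"] e b' by auto
  define t where "t = e / (3 * V)"
  have t: "t > 0" using e V by (simp add: t_def)
  have cv: "convergent (\<lambda>n. set_lebesgue_integral N E (u' n))" if "E \<in> sets N" for E
    using conv[OF that] unfolding convergent_def by blast
  obtain k where k: "\<And>n m. n \<ge> k \<Longrightarrow> m \<ge> k \<Longrightarrow> 
      AE x in N. x \<in> space N - X \<longrightarrow> \<bar>u' n x - u' m x\<bar> \<le> t"
    using AE_uniformly_Cauchy_of_set_integrals[OF finN bd setsN meas(1) bound(1) cv _ Xeq t] by auto
  have int: "integrable N (u' n)" "integrable N u" for n
    by (rule integrable_const_bound[where B=b]; use bound in simp)+
  have intE: "set_integrable N E (u' n)" "set_integrable N E u" if "E \<in> sets N" for E n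
    unfolding set_integrable_def by (rule integrable_mult_indicator[OF that int(1)],
        rule integrable_mult_indicator[OF that int(2)])
  have good: "\<bar>LINT x:E|N. u' n x - u x\<bar> \<le> t * V" 
    if E[measurable]: "E \<in> sets N" and "E \<subseteq> space N - X" and n: "n \<ge> k" for E n
  proof (rule LIMSEQ_le_const2)
    show "(\<lambda>m. \<bar>LINT x:E|N. u' n x - u' m x\<bar>) \<longlonglongrightarrow> \<bar>LINT x:E|N. u' n x - u x\<bar>"
      unfolding set_integral_diff(2)[OF intE(1)[OF E] intE(1)[OF E]]
        set_integral_diff(2)[OF intE(1)[OF E] intE(2)[OF E]]
      by (intro tendsto_intros conv E)
    have "\<bar>LINT x:E|N. u' n x - u' m x\<bar> \<le> t * V" if "m \<ge> k" for m
    proof -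
      have "\<bar>LINT x:E|N. u' n x - u' m x\<bar> \<le> (\<integral>x. t \<partial>N)"
        unfolding set_lebesgue_integral_def
      proof (rule order_trans[OF integral_abs_bound], rule integral_mono_AE)
        show "integrable N (\<lambda>x. \<bar>indicator E x *\<^sub>R (u' n x - u' m x)\<bar>)"
          using int by (intro integrable_abs integrable_mult_indicator) auto
        show "AE x in N. \<bar>indicator E x *\<^sub>R (u' n x - u' m x)\<bar> \<le> t"
          using k[OF n that] 
          by eventually_elim (use \<open>E \<subseteq> _\<close> t in \<open>auto simp: indicator_def\<close>)
      qed auto
      also have "\<dots> \<le> t * V" using V(2)[of "space N"] t by (simp add: mult.commute)
      finally show ?thesis .
    qed
    then show "\<exists>K. \<forall>m\<ge>K. \<bar>LINT x:E|N. u' n x - u' m x\<bar> \<le> t * V" by blast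
  qed
  show "\<forall>\<^sub>F n in sequentially. L1_norm N (\<lambda>x. u' n x - u x) \<le> ennreal e"
    unfolding eventually_sequentially
  proof (intro exI[of _ k] allI impI)
    fix n assume n: "k \<le> n"
    define E1 where "E1 = {x\<in>space N. x \<notin> X \<and> u' n x \<ge> u x}"
    define E2 where "E2 = {x\<in>space N. x \<notin> X \<and> u' n x < u x}"
    have E[measurable]: "E1 \<in> sets N" "E2 \<in> sets N" unfolding E1_def E2_def by measurable
    have diff: "integrable N (\<lambda>x. u' n x - u x)" using int by auto
    have ints: "integrable N (\<lambda>x. indicator E1 x *\<^sub>R (u' n x - u x))"
      "integrable N (\<lambda>x. indicator E2 x *\<^sub>R (u' n x - u x))"
      "integrable N (\<lambda>x. indicator X x *\<^sub>R \<bar>u' n x - u x\<bar>)"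
      by (rule integrable_mult_indicator[OF E(1) diff], rule integrable_mult_indicator[OF E(2) diff],
          rule integrable_mult_indicator[OF X integrable_abs[OF diff]])
    have "L1_norm N (\<lambda>x. u' n x - u x) = ennreal (\<integral>x. \<bar>u' n x - u x\<bar> \<partial>N)"
      unfolding L1_norm_def using int by (intro nn_integral_eq_integral) auto
    also have "(\<integral>x. \<bar>u' n x - u x\<bar> \<partial>N) = 
       (\<integral>x. indicator E1 x *\<^sub>R (u' n x - u x) - indicator E2 x *\<^sub>R (u' n x - u x) 
          + indicator X x *\<^sub>R \<bar>u' n x - u x\<bar> \<partial>N)"
      by (intro Bochner_Integration.integral_cong refl) (auto simp: E1_def E2_def indicator_def)
    also have "\<dots> = (LINT x:E1|N. u' n x - u x) - (LINT x:E2|N. u' n x - u x) 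
        + (LINT x:X|N. \<bar>u' n x - u x\<bar>)"
      unfolding set_lebesgue_integral_def by (simp only: Bochner_Integration.integral_add 
          Bochner_Integration.integral_diff Bochner_Integration.integrable_diff ints)
    also have "\<dots> \<le> t * V + t * V + e/3"
    proof -
      have "(LINT x:X|N. \<bar>u' n x - u x\<bar>) \<le> (LINT x:X|N. 2 * b')"
      proof (rule set_integral_mono)
        show "set_integrable N X (\<lambda>x. \<bar>u' n x - u x\<bar>)"
          using ints(3) by (simp add: set_integrable_def)
        show "set_integrable N X (\<lambda>x. 2 * b')"
          unfolding set_integrable_def by (rule integrable_mult_indicator[OF X]) simp
        fix x assume "x \<in> X"
        then have "x \<in> space N" using sets.sets_into_space[OF X] by auto
        then show "\<bar>u' n x - u x\<bar> \<le> 2 * b'" using bound(1)[of x n] bound(2)[of x] b' by linarith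
      qed
      also have "\<dots> = 2 * b' * measure N X"
        by (simp add: set_lebesgue_integral_def)
      also have "\<dots> \<le> 2 * b' * (e / (6 * b'))"
        using Xd e b' by (intro mult_left_mono) (auto simp: emeasure_eq_measure ennreal_less_iff)
      also have "\<dots> = e/3" using b' by simp
      finally have "(LINT x:X|N. \<bar>u' n x - u x\<bar>) \<le> e/3" .
      moreover have "E1 \<subseteq> space N - X" "E2 \<subseteq> space N - X" by (auto simp: E1_def E2_def)
      ultimately show ?thesis
        using good[OF E(1) _ n] good[OF E(2) _ n] by linarith
    qed
    also have "\<dots> = e" using V(1) by (simp add: t_def)
    finally show "L1_norm N (\<lambda>x. u' n x - u x) \<le> ennreal e" by (simp add: ennreal_leI)
  qed
qed

section \<open>The posterior densities\<close>

text \<open>The push-forward of \<open>P\<close> under \<open>T\<close> contributes the weight \<open>q'\<close>, which cancels the possibly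
  unbounded factor \<open>1/q'\<close>: where no denominator vanishes, \<open>q' * \<bar>p/q' - p/q\<bar> = (p/q) * \<bar>q' - q\<bar>\<close>, and \<open>p/q\<close> is at most \<open>c\<close>.
  This is why closeness of densities in L1 is enough, without any lower bound on them.\<close>
lemma L1_norm_ratio_le:
  assumes T: "distributed P N T (\<lambda>y. ennreal (q' y))"
    and meas[measurable]: "q' \<in> borel_measurable N" "q \<in> borel_measurable N" "p \<in> borel_measurable N"
    and nonneg: "\<And>y. y \<in> space N \<Longrightarrow> 0 \<le> q' y" "\<And>y. y \<in> space N \<Longrightarrow> 0 \<le> q y"
      "\<And>y. y \<in> space N \<Longrightarrow> 0 \<le> p y"
    and dom: "AE y in N. p y \<le> c * q y" and c: "0 \<le> c"
  shows "L1_norm P (\<lambda>x. p (T x) / q' (T x) - p (T x) / q (T x))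
    \<le> ennreal c * L1_norm N (\<lambda>y. q' y - q y)"
proof -
  have "L1_norm P (\<lambda>x. p (T x) / q' (T x) - p (T x) / q (T x))
     = (\<integral>\<^sup>+y. ennreal (q' y) * ennreal \<bar>p y / q' y - p y / q y\<bar> \<partial>N)"
    unfolding L1_norm_def by (rule distributed_nn_integral[OF T, symmetric]) auto
  also have "\<dots> \<le> (\<integral>\<^sup>+y. ennreal c * ennreal \<bar>q' y - q y\<bar> \<partial>N)"
  proof (rule nn_integral_mono_AE)
    show "AE y in N. ennreal (q' y) * ennreal \<bar>p y / q' y - p y / q y\<bar>
        \<le> ennreal c * ennreal \<bar>q' y - q y\<bar>"
      using dom AE_space
    proof eventually_elim
      case (elim y)
      note nn = nonneg(1)[OF elim(2)] nonneg(2)[OF elim(2)] nonneg(3)[OF elim(2)]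
      have "q' y * \<bar>p y / q' y - p y / q y\<bar> \<le> c * \<bar>q' y - q y\<bar>"
      proof (cases "q y = 0 \<or> q' y = 0")
        case True
        \<comment> \<open>If \<open>q\<close> vanishes, so does \<open>p\<close>; if \<open>q'\<close> vanishes, the weight is zero.
          In both cases the left-hand side is zero.\<close>
        then show ?thesis using elim nn c by auto
      next
        case False
        then have pos: "q y > 0" "q' y > 0" using nn by auto
        have "q' y * \<bar>p y / q' y - p y / q y\<bar> = \<bar>q' y * (p y / q' y - p y / q y)\<bar>"
          using pos by (simp add: abs_mult)
        also have "q' y * (p y / q' y - p y / q y) = (p y / q y) * (q y - q' y)"
          using pos by (simp add: field_simps)
        also have "\<bar>\<dots>\<bar> = (p y / q y) * \<bar>q' y - q y\<bar>"
          using pos nn by (simp add: abs_mult abs_minus_commute)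
        also have "\<dots> \<le> c * \<bar>q' y - q y\<bar>"
          using elim pos by (intro mult_right_mono) (auto simp: field_simps)
        finally show ?thesis .
      qed
      then show ?case using nn c by (simp add: ennreal_leI flip: ennreal_mult)
    qed
  qed
  also have "\<dots> = ennreal c * L1_norm N (\<lambda>y. q' y - q y)"
    unfolding L1_norm_def by (rule nn_integral_cmult) auto
  finally show ?thesis .
qed

lemma pushforward_densityD:
  assumes "pushforward_density M p N T q"
  shows "\<And>y. y \<in> space N \<Longrightarrow> 0 \<le> q y"
    and "distributed (density M (\<lambda>x. ennreal (p x))) N T (\<lambda>y. ennreal (q y))"
    and "q \<in> borel_measurable N"
  using assms distributed_real_measurable[of N q "density M (\<lambda>x. ennreal (p x))" T]
  unfolding pushforward_density_def by auto

text \<open>Both posteriors carry the prior as a factor, which is absorbed into the measure; the distance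
  to be estimated is then one between two ratios under the prior probability.\<close>
lemma L1_norm_posterior_density_diff:
  assumes p: "prob_density M p"
    and T: "distributed (density M (\<lambda>x. ennreal (p x))) N T (\<lambda>y. ennreal (q y))"
      "q \<in> borel_measurable N"
    and U: "distributed (density M (\<lambda>x. ennreal (p x))) N U (\<lambda>y. ennreal (r y))"
      "r \<in> borel_measurable N"
    and obs: "obs \<in> borel_measurable N"
  shows "L1_norm M (\<lambda>x. posterior_density p obs q T x - posterior_density p obs r U x) =
    L1_norm (density M (\<lambda>x. ennreal (p x))) (\<lambda>x. obs (T x) / q (T x) - obs (U x) / r (U x))"
proof -
  have [measurable]: "p \<in> borel_measurable M" and p0: "\<And>x. x \<in> space M \<Longrightarrow> 0 \<le> p x"
    using p by (auto simp: prob_density_def)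
  have [measurable]: "T \<in> measurable M N" "U \<in> measurable M N"
    using distributed_measurable[OF T(1)] distributed_measurable[OF U(1)] by simp_all
  note [measurable] = T(2) U(2) obs
  have factor: "ennreal \<bar>p x * a - p x * b\<bar> = ennreal (p x) * ennreal \<bar>a - b\<bar>"
    if "x \<in> space M" for x a b
    using p0[OF that] by (simp add: abs_mult ennreal_mult flip: right_diff_distrib)
  show ?thesis
    unfolding L1_norm_def posterior_density_def
  proof (subst nn_integral_density)
    show "(\<integral>\<^sup>+x. ennreal \<bar>p x * (obs (T x) / q (T x)) - p x * (obs (U x) / r (U x))\<bar> \<partial>M)
      = (\<integral>\<^sup>+x. ennreal (p x) * ennreal \<bar>obs (T x) / q (T x) - obs (U x) / r (U x)\<bar> \<partial>M)"
      by (rule nn_integral_cong) (rule factor)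
  qed measurable
qed

theorem theorem6:
  fixes \<Lambda> :: "(real^'k) set"
    and D A :: "(real^'m) set"
    and \<mu>\<^sub>\<Lambda> :: "(real^'k) measure"
    and \<mu>\<^sub>D :: "(real^'m) measure"
    and Q :: "real^'k \<Rightarrow> real^'m"
    and Qn :: "nat \<Rightarrow> real^'k \<Rightarrow> real^'m"
    and \<pi>\<^sub>\<Lambda> :: "real^'k \<Rightarrow> real"
    and \<pi>\<^sub>D \<pi>\<^sub>D\<^sub>Q :: "real^'m \<Rightarrow> real"
    and \<pi>\<^sub>D\<^sub>Q\<^sub>n :: "nat \<Rightarrow> real^'m \<Rightarrow> real"
  assumes precompact: "bounded \<Lambda>"
    and D: "D = Q ` \<Lambda>"
    and sets_\<Lambda>: "sets \<mu>\<^sub>\<Lambda> = sets (restrict_space borel \<Lambda>)"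
    and sets_D: "sets \<mu>\<^sub>D = sets (restrict_space borel D)"
    and finite_D: "emeasure \<mu>\<^sub>D D < \<infinity>"
    and Q_measurable: "Q \<in> measurable \<mu>\<^sub>\<Lambda> \<mu>\<^sub>D"
    and Q_smooth: "piecewise_smooth_on \<Lambda> Q"
    and Q_bounded: "bounded (Q ` \<Lambda>)"
    and dominating:
      "\<mu>\<^sub>D = distr \<mu>\<^sub>\<Lambda> \<mu>\<^sub>D Q \<or> absolutely_continuous \<mu>\<^sub>D (distr \<mu>\<^sub>\<Lambda> \<mu>\<^sub>D Q)"
    and Qn_measurable: "\<And>n. Qn n \<in> measurable \<mu>\<^sub>\<Lambda> \<mu>\<^sub>D"
    and Qn_conv: "(\<lambda>n. Linf_norm \<mu>\<^sub>\<Lambda> (\<lambda>x. Qn n x - Q x)) \<longlonglongrightarrow> 0"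
    and prior: "prob_density \<mu>\<^sub>\<Lambda> \<pi>\<^sub>\<Lambda>"
    and push_Q: "pushforward_density \<mu>\<^sub>\<Lambda> \<pi>\<^sub>\<Lambda> \<mu>\<^sub>D Q \<pi>\<^sub>D\<^sub>Q"
    and push_Qn: "\<And>n. pushforward_density \<mu>\<^sub>\<Lambda> \<pi>\<^sub>\<Lambda> \<mu>\<^sub>D (Qn n) (\<pi>\<^sub>D\<^sub>Q\<^sub>n n)"
    and observed: "prob_density \<mu>\<^sub>D \<pi>\<^sub>D"
    and observed_lipschitz: "\<exists>L. L-lipschitz_on D \<pi>\<^sub>D"
    and bound_Q: "\<exists>B1>0. \<forall>q\<in>D. \<pi>\<^sub>D\<^sub>Q q \<le> B1"
    and A_null: "A \<in> null_sets \<mu>\<^sub>D"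
    and cont_Q: "\<forall>q\<in>D - A. continuous (at q within D) \<pi>\<^sub>D\<^sub>Q"
    and bound_Qn: "\<exists>B2>0. \<forall>n. \<forall>q\<in>D. \<pi>\<^sub>D\<^sub>Q\<^sub>n n q \<le> B2"
    and equicont_Qn:
      "\<forall>\<delta>>0. \<exists>N\<^sub>\<delta>\<in>sets \<mu>\<^sub>D. A \<subseteq> N\<^sub>\<delta> \<and> emeasure \<mu>\<^sub>D N\<^sub>\<delta> < ennreal \<delta> \<and>
         asymp_unif_equicontinuous_on (D - N\<^sub>\<delta>) \<pi>\<^sub>D\<^sub>Q\<^sub>n"
    and pred_Q: "\<exists>C>0. AE q in \<mu>\<^sub>D. \<pi>\<^sub>D q \<le> C * \<pi>\<^sub>D\<^sub>Q q"
    and pred_Qn: "\<exists>C>0. \<forall>n. AE q in \<mu>\<^sub>D. \<pi>\<^sub>D q \<le> C * \<pi>\<^sub>D\<^sub>Q\<^sub>n n q"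
  shows "\<forall>\<epsilon>>0. \<exists>N. \<forall>n>N.
           L1_norm \<mu>\<^sub>\<Lambda> (\<lambda>x. posterior_density \<pi>\<^sub>\<Lambda> \<pi>\<^sub>D (\<pi>\<^sub>D\<^sub>Q\<^sub>n n) (Qn n) x
                           - posterior_density \<pi>\<^sub>\<Lambda> \<pi>\<^sub>D \<pi>\<^sub>D\<^sub>Q Q x) < ennreal \<epsilon>"
proof -
  define P where "P = density \<mu>\<^sub>\<Lambda> (\<lambda>x. ennreal (\<pi>\<^sub>\<Lambda> x))"
  have spD: "space \<mu>\<^sub>D = D"
    using sets_eq_imp_space_eq[OF sets_D] by (simp add: space_restrict_space)
  have finD: "finite_measure \<mu>\<^sub>D"
    using finite_D by (intro finite_measureI) (simp add: spD)
  interpret D: finite_measure \<mu>\<^sub>D by (rule finD)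
  have [measurable]: "\<pi>\<^sub>\<Lambda> \<in> borel_measurable \<mu>\<^sub>\<Lambda>" and obs[measurable]: "\<pi>\<^sub>D \<in> borel_measurable \<mu>\<^sub>D"
    and obs0: "\<And>y. y \<in> space \<mu>\<^sub>D \<Longrightarrow> 0 \<le> \<pi>\<^sub>D y"
    using prior observed by (auto simp: prob_density_def)
  have finP: "finite_measure P"
    using prior
    by (intro finite_measureI) (auto simp: P_def prob_density_def emeasure_density cong: nn_integral_cong)
  note dQ = pushforward_densityD[OF push_Q, folded P_def]
  note dQn = pushforward_densityD[OF push_Qn, folded P_def]
  note [measurable] = dQ(3) dQn(3)
  have [measurable]: "Q \<in> measurable P \<mu>\<^sub>D" "\<And>n. Qn n \<in> measurable P \<mu>\<^sub>D"
    using Q_measurable Qn_measurable by (simp_all add: P_def)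
  obtain B1 B2 where "\<And>y. y \<in> D \<Longrightarrow> \<pi>\<^sub>D\<^sub>Q y \<le> B1" "\<And>n y. y \<in> D \<Longrightarrow> \<pi>\<^sub>D\<^sub>Q\<^sub>n n y \<le> B2"
    using bound_Q bound_Qn by metis
  then obtain b where b: "\<And>y. y \<in> space \<mu>\<^sub>D \<Longrightarrow> \<pi>\<^sub>D\<^sub>Q y \<le> b" "\<And>n y. y \<in> space \<mu>\<^sub>D \<Longrightarrow> \<pi>\<^sub>D\<^sub>Q\<^sub>n n y \<le> b"
    unfolding spD by (metis max.coboundedI1 max.coboundedI2)
  obtain C where C: "C > 0" "AE y in \<mu>\<^sub>D. \<pi>\<^sub>D y \<le> C * \<pi>\<^sub>D\<^sub>Q y" using pred_Q by auto
  have conv: "AE x in P. (\<lambda>n. Qn n x) \<longlonglongrightarrow> Q x"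
    using AE_tendsto_of_Linf_norm[OF Qn_conv] unfolding P_def by (subst AE_density) auto
  have densities: "(\<lambda>n. L1_norm \<mu>\<^sub>D (\<lambda>y. \<pi>\<^sub>D\<^sub>Q\<^sub>n n y - \<pi>\<^sub>D\<^sub>Q y)) \<longlonglongrightarrow> 0"
  proof (rule L1_convergence_of_set_integrals[OF finD _ sets_D])
    show "bounded (space \<mu>\<^sub>D)" using Q_bounded by (simp add: spD D)
    show "\<bar>\<pi>\<^sub>D\<^sub>Q\<^sub>n n y\<bar> \<le> b" "\<bar>\<pi>\<^sub>D\<^sub>Q y\<bar> \<le> b" if "y \<in> space \<mu>\<^sub>D" for n y
      using dQ(1) dQn(1) b that by auto
    show "\<exists>X\<in>sets \<mu>\<^sub>D. emeasure \<mu>\<^sub>D X < ennreal d \<and> 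
        asymp_unif_equicontinuous_on (space \<mu>\<^sub>D - X) \<pi>\<^sub>D\<^sub>Q\<^sub>n" if "d > 0" for d
      using equicont_Qn that unfolding spD by blast
    show "(\<lambda>n. set_lebesgue_integral \<mu>\<^sub>D E (\<pi>\<^sub>D\<^sub>Q\<^sub>n n)) \<longlonglongrightarrow> set_lebesgue_integral \<mu>\<^sub>D E \<pi>\<^sub>D\<^sub>Q"
      if "E \<in> sets \<mu>\<^sub>D" for E
      by (rule set_integral_density_convergence[OF finP finD sets_D dQn(2) dQ(2) dQn(1) dQ(1) b(2,1) conv that])
  qed auto
  \<comment> \<open>The exact ratio. It is bounded almost everywhere because the observed density is dominated by
    the exact push-forward density, hence it is integrable over the data space of finite measure.\<close>
  define r where "r y = \<pi>\<^sub>D y / \<pi>\<^sub>D\<^sub>Q y" for y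
  have [measurable]: "r \<in> borel_measurable \<mu>\<^sub>D" unfolding r_def by measurable
  have "AE y in \<mu>\<^sub>D. norm (r y) \<le> C"
    using C(2) AE_space
  proof eventually_elim
    case (elim y)
    then show ?case
      using obs0[of y] dQ(1)[of y] C(1)
      by (cases "\<pi>\<^sub>D\<^sub>Q y = 0") (auto simp: r_def divide_le_eq)
  qed
  then have r: "integrable \<mu>\<^sub>D r" by (intro D.integrable_const_bound) auto
  have shift: "(\<lambda>n. L1_norm P (\<lambda>x. r (Qn n x) - r (Q x))) \<longlonglongrightarrow> 0"
    by (rule L1_convergence_comp[OF finP finD sets_D dQn(2) dQ(2) b(2,1) conv r])
  have "(\<lambda>n. ennreal C * L1_norm \<mu>\<^sub>D (\<lambda>y. \<pi>\<^sub>D\<^sub>Q\<^sub>n n y - \<pi>\<^sub>D\<^sub>Q y)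
      + L1_norm P (\<lambda>x. r (Qn n x) - r (Q x))) \<longlonglongrightarrow> ennreal C * 0 + 0"
    by (intro tendsto_add ennreal_tendsto_cmult densities shift) auto
  then have lim: "(\<lambda>n. ennreal C * L1_norm \<mu>\<^sub>D (\<lambda>y. \<pi>\<^sub>D\<^sub>Q\<^sub>n n y - \<pi>\<^sub>D\<^sub>Q y)
      + L1_norm P (\<lambda>x. r (Qn n x) - r (Q x))) \<longlonglongrightarrow> 0" by simp
  \<comment> \<open>Between the two posteriors stands the exact ratio evaluated along the approximate map.\<close>
  have bound: "L1_norm \<mu>\<^sub>\<Lambda> (\<lambda>x. posterior_density \<pi>\<^sub>\<Lambda> \<pi>\<^sub>D (\<pi>\<^sub>D\<^sub>Q\<^sub>n n) (Qn n) x
          - posterior_density \<pi>\<^sub>\<Lambda> \<pi>\<^sub>D \<pi>\<^sub>D\<^sub>Q Q x)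
      \<le> ennreal C * L1_norm \<mu>\<^sub>D (\<lambda>y. \<pi>\<^sub>D\<^sub>Q\<^sub>n n y - \<pi>\<^sub>D\<^sub>Q y) + L1_norm P (\<lambda>x. r (Qn n x) - r (Q x))" for n
  proof -
    have "L1_norm \<mu>\<^sub>\<Lambda> (\<lambda>x. posterior_density \<pi>\<^sub>\<Lambda> \<pi>\<^sub>D (\<pi>\<^sub>D\<^sub>Q\<^sub>n n) (Qn n) x
          - posterior_density \<pi>\<^sub>\<Lambda> \<pi>\<^sub>D \<pi>\<^sub>D\<^sub>Q Q x)
        = L1_norm P (\<lambda>x. \<pi>\<^sub>D (Qn n x) / \<pi>\<^sub>D\<^sub>Q\<^sub>n n (Qn n x) - r (Q x))"
      unfolding P_def r_def
      by (rule L1_norm_posterior_density_diff[OF prior dQn(2,3)[unfolded P_def] dQ(2,3)[unfolded P_def] obs])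
    also have "\<dots> \<le> L1_norm P (\<lambda>x. \<pi>\<^sub>D (Qn n x) / \<pi>\<^sub>D\<^sub>Q\<^sub>n n (Qn n x) - r (Qn n x))
        + L1_norm P (\<lambda>x. r (Qn n x) - r (Q x))"
      by (rule L1_norm_triangle) measurable
    also have "L1_norm P (\<lambda>x. \<pi>\<^sub>D (Qn n x) / \<pi>\<^sub>D\<^sub>Q\<^sub>n n (Qn n x) - r (Qn n x))
        \<le> ennreal C * L1_norm \<mu>\<^sub>D (\<lambda>y. \<pi>\<^sub>D\<^sub>Q\<^sub>n n y - \<pi>\<^sub>D\<^sub>Q y)"
      unfolding r_def
      by (rule L1_norm_ratio_le[OF dQn(2) dQn(3) dQ(3) obs dQn(1) dQ(1) obs0 C(2)]) (use C in auto)
    finally show ?thesis by (simp add: add_right_mono)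
  qed
  show ?thesis
  proof (intro allI impI)
    fix \<epsilon> :: real assume "\<epsilon> > 0"
    then obtain K where "\<And>n. n \<ge> K \<Longrightarrow> ennreal C * L1_norm \<mu>\<^sub>D (\<lambda>y. \<pi>\<^sub>D\<^sub>Q\<^sub>n n y - \<pi>\<^sub>D\<^sub>Q y)
        + L1_norm P (\<lambda>x. r (Qn n x) - r (Q x)) < ennreal \<epsilon>"
      using ennreal_tendsto_0D[OF lim] unfolding eventually_sequentially by blast
    then show "\<exists>N. \<forall>n>N. L1_norm \<mu>\<^sub>\<Lambda> (\<lambda>x. posterior_density \<pi>\<^sub>\<Lambda> \<pi>\<^sub>D (\<pi>\<^sub>D\<^sub>Q\<^sub>n n) (Qn n) x
        - posterior_density \<pi>\<^sub>\<Lambda> \<pi>\<^sub>D \<pi>\<^sub>D\<^sub>Q Q x) < ennreal \<epsilon>"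
      using le_less_trans[OF bound] by (meson less_imp_le)
  qed
qed

end
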